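(* Let $p:\mathbb{R}^n\to\mathbb{R}$ be a cubic polynomial written in the form $$p(x)=\frac{1}{6}\sum_{i=1}^n x^Tx_iH_ix+\frac{1}{2}x^TQx+b^Tx,$$ where $b\in\mathbb{R}^n$ and $H_1,\ldots,H_n,Q$ are real symmetric $n\times n$ matrices with $(H_i)_{jk}=(H_j)_{ik}=(H_k)_{ij}$ for all $i,j,k$. Let $\Omega$ be the set of all $y\in\mathbb{R}^n$ for which there exist a real symmetric $n\times n$ matrix $Y$ and $z\in\mathbb{R}$ such that $$\frac{1}{2}\mathrm{Tr}(QY)+b^Ty+\frac{z}{2}=0,\qquad \frac{1}{2}\mathrm{Tr}(H_iY)+e_i^TQy+b_i=0\ \ \forall i=1,\ldots,n,$$ $$\begin{bmatrix} \sum_{i=1}^n y_iH_i+Q & \sum_{i=1}^n \mathrm{Tr}(H_iY)e_i+Qy\\ \left(\sum_{i=1}^n \mathrm{Tr}(H_iY)e_i+Qy\right)^T & z\end{bmatrix}\succeq 0,\qquad \begin{bmatrix} Y & y\\ y^T & 1\end{bmatrix}\succeq 0.$$ Consider the following algorithm: (1) test with one call to the oracle E-SDP whether $\Omega$ is empty; if so, return ``NO LOCAL MINIMUM''; (2) otherwise, find a point $x^*$ in the relative interior of $\Omega$ using $2n$ calls to E-SDP; (3) test whether $x^*$ is a local minimum of $p$, by checking that $\nabla p(x^* )=0$, $\nabla^2 p(x^* )\succeq 0$, and $\nabla p_3$ vanishes on the null space of $\nabla^2 p(x^* )$; if so, return $x^*$, and otherwise return ``NO LOCAL MINIMUM''.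 Then this algorithm (in which step (2) can always be carried out as stated) makes at most $2n+1$ calls to E-SDP, and it is correct: if $p$ has a local minimum it returns a local minimum of $p$, and if $p$ has no local minimum it returns ``NO LOCAL MINIMUM''.
   Context: A cubic polynomial is a real polynomial all of whose monomials have degree at most 3 (the constant term is taken to be 0); $p_3$ is the sum of its terms of degree exactly 3. A point $\bar x$ is a local minimum of $p$ if there is $\epsilon>0$ such that $p(\bar x)\le p(y)$ for all $y$ with $\|y-\bar x\|\le\epsilon$. $e_i$ is the $i$-th coordinate vector, $\mathrm{Tr}$ the trace, and $M\succeq 0$ means positive semidefinite. The computational model allows exact arithmetic over the real numbers together with an oracle E-SDP, which takes as input a semidefinite program with real data and outputs its optimal value as a real number if it is finite, or reports that the program is infeasible, or that it is unbounded. The relative interior of a nonempty convex set $S\subseteq\mathbb{R}^n$ is $\{x\in S \mid \forall y\in S,\ \exists\lambda>1 \text{ such that } \lambda x+(1-\lambda)y\in S\}$. A point in the relative interior of $\Omega$ is found in step (2) as follows: set $S_1=\Omega$; for $i=1,\ldots,n$ compute with two calls to E-SDP the supremum and infimum (possibly infinite) of $x_i$ over $S_i$, let $x_i^*$ be their common value if they coincide and otherwise any scalar strictly between them, and set $S_{i+1}=S_i\cap\{x \mid x_i=x_i^*\}$; output the point $x^*=(x_1^*,\ldots,x_n^* )$. *)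

theory Defs
  imports "HOL-Analysis.Analysis"
begin

section \<open>Matrices, derivatives, local minima\<close>

definition psd :: "real^'n^'n \<Rightarrow> bool" where
  "psd A \<longleftrightarrow> transpose A = A \<and> (\<forall>v. 0 \<le> v \<bullet> (A *v v))"

(* The block matrix [M, v; v^T, s]; the index None is the last row and column. *)
definition bordered :: "real^'n^'n \<Rightarrow> real^'n \<Rightarrow> real \<Rightarrow> real^('n option)^('n option)" where
  "bordered M v s = (\<chi> r c. case (r, c) of
       (Some i, Some j) \<Rightarrow> M $ i $ j
     | (Some i, None) \<Rightarrow> v $ i
     | (None, Some j) \<Rightarrow> v $ j
     | (None, None) \<Rightarrow> s)"

definition gradient :: "(real^'n \<Rightarrow> real) \<Rightarrow> real^'n \<Rightarrow> real^'n" where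
  "gradient f x = (\<chi> i. frechet_derivative f (at x) (axis i 1))"

definition hessian :: "(real^'n \<Rightarrow> real) \<Rightarrow> real^'n \<Rightarrow> real^'n^'n" where
  "hessian f x = matrix (frechet_derivative (gradient f) (at x))"

definition local_minimum :: "(real^'n \<Rightarrow> real) \<Rightarrow> real^'n \<Rightarrow> bool" where
  "local_minimum f x \<longleftrightarrow> (\<exists>\<epsilon>>0. \<forall>y. norm (y - x) \<le> \<epsilon> \<longrightarrow> f x \<le> f y)"

(* On nonempty convex sets the library's rel_interior is the "prolongation" definition
   of the relative interior. *)
lemma rel_interior_prolongation:
  fixes S :: "(real^'n) set"
  assumes "convex S" and "S \<noteq> {}"
  shows "rel_interior S = {x \<in> S. \<forall>y\<in>S. \<exists>l>1. l *\<^sub>R x + (1 - l) *\<^sub>R y \<in> S}"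
  using convex_rel_interior_iff[OF assms] rel_interior_subset[of S]
  by (auto simp: add.commute)


section \<open>Cubic polynomials and the set \<open>\<Omega>\<close>\<close>

definition cubic_part :: "('n \<Rightarrow> real^'n^'n) \<Rightarrow> real^'n \<Rightarrow> real" where
  "cubic_part H x = 1/6 * (\<Sum>i\<in>UNIV. x \<bullet> ((x $ i *\<^sub>R H i) *v x))"

definition cubic :: "('n \<Rightarrow> real^'n^'n) \<Rightarrow> real^'n^'n \<Rightarrow> real^'n \<Rightarrow> real^'n \<Rightarrow> real" where
  "cubic H Q b x = cubic_part H x + 1/2 * (x \<bullet> (Q *v x)) + b \<bullet> x"

definition Omega :: "('n \<Rightarrow> real^'n^'n) \<Rightarrow> real^'n^'n \<Rightarrow> real^'n \<Rightarrow> (real^'n) set" where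
  "Omega H Q b = {y. \<exists>Y z. transpose Y = Y \<and>
     1/2 * trace (Q ** Y) + b \<bullet> y + z / 2 = 0 \<and>
     (\<forall>i. 1/2 * trace (H i ** Y) + axis i 1 \<bullet> (Q *v y) + b $ i = 0) \<and>
     psd (bordered ((\<Sum>i\<in>UNIV. y $ i *\<^sub>R H i) + Q)
                   ((\<Sum>i\<in>UNIV. trace (H i ** Y) *\<^sub>R axis i 1) + Q *v y) z) \<and>
     psd (bordered Y y 1)}"


section \<open>Semidefinite programs and the oracle\<close>

datatype sense = Minimize | Maximize

(* Optimize a linear functional of v subject to a v = \<beta> for (a, \<beta>) in equalities and
   A v + A0 psd for (A, A0) in lmis.  The real data of a program are the coefficients of the
   linear maps objective, a and A. *)
record ('v, 'm::finite) sdp =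
  sense :: sense
  objective :: "'v \<Rightarrow> real"
  equalities :: "(('v \<Rightarrow> real) \<times> real) set"
  lmis :: "(('v \<Rightarrow> real^'m^'m) \<times> (real^'m^'m)) set"

definition is_sdp :: "('v::euclidean_space, 'm::finite) sdp \<Rightarrow> bool" where
  "is_sdp P \<longleftrightarrow> linear (objective P) \<and>
     finite (equalities P) \<and> (\<forall>(a, \<beta>)\<in>equalities P. linear a) \<and>
     finite (lmis P) \<and>
     (\<forall>(A, A0)\<in>lmis P. linear A \<and> (\<forall>v. transpose (A v) = A v) \<and> transpose A0 = A0)"

definition sdp_feasible :: "('v, 'm::finite) sdp \<Rightarrow> 'v set" where
  "sdp_feasible P = {v. (\<forall>(a, \<beta>)\<in>equalities P. a v = \<beta>) \<and> (\<forall>(A, A0)\<in>lmis P. psd (A v + A0))}"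

datatype answer = Infeasible | Unbounded | Optimal real

definition sdp_answer :: "('v, 'm::finite) sdp \<Rightarrow> answer" where
  "sdp_answer P =
     (let values = objective P ` sdp_feasible P in
      if sdp_feasible P = {} then Infeasible
      else case sense P of
        Minimize \<Rightarrow> if bdd_below values then Optimal (Inf values) else Unbounded
      | Maximize \<Rightarrow> if bdd_above values then Optimal (Sup values) else Unbounded)"

(* Nothing is known about the oracle on inputs that are not semidefinite programs. *)
definition E_SDP_oracle :: "(('v::euclidean_space, 'm::finite) sdp \<Rightarrow> answer) \<Rightarrow> bool" where
  "E_SDP_oracle E \<longleftrightarrow> (\<forall>P. is_sdp P \<longrightarrow> E P = sdp_answer P)"


section \<open>Nondeterministic computations with an oracle\<close>

(* Call q k queries the oracle with q and continues with k applied to its answer;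
   Choose A k continues with k x for an arbitrary x in A, and is stuck if A is empty. *)
datatype ('q, 'a, 'r) comp =
    Return 'r
  | Call 'q "'a \<Rightarrow> ('q, 'a, 'r) comp"
  | Choose "real set" "real \<Rightarrow> ('q, 'a, 'r) comp"

primrec bind :: "('q, 'a, 'r) comp \<Rightarrow> ('r \<Rightarrow> ('q, 'a, 's) comp) \<Rightarrow> ('q, 'a, 's) comp" where
  "bind (Return r) f = f r"
| "bind (Call q k) f = Call q (\<lambda>a. bind (k a) f)"
| "bind (Choose A k) f = Choose A (\<lambda>x. bind (k x) f)"

(* The pairs (number of oracle calls, result) over all complete runs. *)
primrec outcomes :: "('q \<Rightarrow> 'a) \<Rightarrow> ('q, 'a, 'r) comp \<Rightarrow> (nat \<times> 'r) set" where
  "outcomes E (Return r) = {(0, r)}"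
| "outcomes E (Call q k) = (\<lambda>(m, r). (Suc m, r)) ` outcomes E (k (E q))"
| "outcomes E (Choose A k) = (\<Union>x\<in>A. outcomes E (k x))"

(* No run ever reaches a choice from the empty set. *)
primrec never_stuck :: "('q \<Rightarrow> 'a) \<Rightarrow> ('q, 'a, 'r) comp \<Rightarrow> bool" where
  "never_stuck E (Return r) \<longleftrightarrow> True"
| "never_stuck E (Call q k) \<longleftrightarrow> never_stuck E (k (E q))"
| "never_stuck E (Choose A k) \<longleftrightarrow> A \<noteq> {} \<and> (\<forall>x\<in>A. never_stuck E (k x))"


section \<open>The algorithm\<close>

(* The syntax real^'n would fix the sort of 'n to be finite only. *)
type_synonym 'n sqmat = "((real, 'n) vec, 'n) vec"

type_synonym 'n decision = "(real^'n) \<times> (real^'n^'n) \<times> real"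
type_synonym 'n program = "('n decision, 'n option) sdp"

(* The feasibility problem in (y, Y, z) whose projection to y is Omega.  The symmetric part of Y
   in the last block makes the linear matrix map symmetric-valued; it is Y itself because of the
   equalities Y_jk - Y_kj = 0. *)
definition Omega_sdp ::
    "('n::finite \<Rightarrow> real^'n^'n) \<Rightarrow> real^'n^'n \<Rightarrow> real^'n \<Rightarrow> 'n program" where
  "Omega_sdp H Q b = \<lparr>
     sense = Minimize,
     objective = (\<lambda>(y, Y, z). 0),
     equalities =
       {(\<lambda>(y, Y, z). 1/2 * trace (Q ** Y) + b \<bullet> y + z / 2, 0)} \<union>
       range (\<lambda>i. (\<lambda>(y, Y, z). 1/2 * trace (H i ** Y) + axis i 1 \<bullet> (Q *v y), - b $ i)) \<union>
       range (\<lambda>(j, k). (\<lambda>(y, Y, z). Y $ j $ k - Y $ k $ j, 0)),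
     lmis =
       {(\<lambda>(y, Y, z). bordered (\<Sum>i\<in>UNIV. y $ i *\<^sub>R H i)
                       ((\<Sum>i\<in>UNIV. trace (H i ** Y) *\<^sub>R axis i 1) + Q *v y) z,
         bordered Q 0 0),
        (\<lambda>(y, Y, z). bordered ((1/2) *\<^sub>R (Y + transpose Y)) y 0,
         bordered 0 0 1)} \<rparr>"

lemma bordered_add: "bordered M v s + bordered M' v' s' = bordered (M + M') (v + v') (s + s')"
  by (auto simp: bordered_def vec_eq_iff split: option.splits)
lemma bordered_scaleR: "r *\<^sub>R bordered M v s = bordered (r *\<^sub>R M) (r *\<^sub>R v) (r * s)"
  by (auto simp: bordered_def vec_eq_iff split: option.splits)

lemma Omega_eq_projection: "Omega H Q b = fst ` sdp_feasible (Omega_sdp H Q b)"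
proof -
  have s: "(1/2) *\<^sub>R (Y + transpose Y) = Y" if "transpose Y = Y" for Y :: "real^'n^'n"
    using that by (simp add: vec_eq_iff)
  have t: "transpose Y = Y \<longleftrightarrow> (\<forall>j k. Y $ j $ k - Y $ k $ j = 0)" for Y :: "real^'n^'n"
    by (auto simp: transpose_def vec_eq_iff)
  have key: "(y, Y, z) \<in> sdp_feasible (Omega_sdp H Q b) \<longleftrightarrow> transpose Y = Y \<and>
     1/2 * trace (Q ** Y) + b \<bullet> y + z / 2 = 0 \<and>
     (\<forall>i. 1/2 * trace (H i ** Y) + axis i 1 \<bullet> (Q *v y) + b $ i = 0) \<and>
     psd (bordered ((\<Sum>i\<in>UNIV. y $ i *\<^sub>R H i) + Q)
                   ((\<Sum>i\<in>UNIV. trace (H i ** Y) *\<^sub>R axis i 1) + Q *v y) z) \<and>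
     psd (bordered Y y 1)" for y Y z
  proof (cases "transpose Y = Y")
    case True
    then have "\<forall>j k. Y $ j $ k - Y $ k $ j = 0" using t by blast
    then show ?thesis
      using True s[OF True]
      by (simp add: sdp_feasible_def Omega_sdp_def ball_Un bordered_add eq_neg_iff_add_eq_0 split_def
            del: right_minus_eq)
  next
    case False
    then obtain j k where "Y $ j $ k - Y $ k $ j \<noteq> 0" using t by blast
    then show ?thesis
      using False by (auto simp: sdp_feasible_def Omega_sdp_def ball_Un split_def)
  qed
  have "y \<in> Omega H Q b \<longleftrightarrow> (\<exists>Y z. (y, Y, z) \<in> sdp_feasible (Omega_sdp H Q b))" for y
    by (simp only: Omega_def mem_Collect_eq key)
  then show ?thesis
    by force
qed

lemma is_sdp_Omega_sdp:
  assumes "\<And>i. transpose (H i) = H i" "transpose Q = Q"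
  shows "is_sdp (Omega_sdp H Q b)"
proof -
  have tr: "transpose (bordered M v s) = bordered (transpose M) v s" for M :: "real^'a^'a" and v s
    by (auto simp: bordered_def transpose_def vec_eq_iff split: option.splits)
  have tH: "transpose (\<Sum>i\<in>UNIV. y $ i *\<^sub>R H i) = (\<Sum>i\<in>UNIV. y $ i *\<^sub>R H i)" for y
    using assms(1) by (simp add: transpose_def vec_eq_iff)
  have tY: "transpose ((1/2) *\<^sub>R (Y + transpose Y)) = (1/2) *\<^sub>R (Y + transpose Y)" for Y :: "real^'a^'a"
    by (simp add: transpose_def vec_eq_iff)
  have t1: "trace (M ** (Y + Z)) = trace (M ** Y) + trace (M ** Z)" for M Y Z :: "real^'a^'a"
    by (simp add: matrix_add_ldistrib trace_add)
  have t2: "trace (M ** (r *\<^sub>R Y)) = r * trace (M ** Y)" for M Y :: "real^'a^'a" and r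
    by (simp add: trace_def matrix_matrix_mult_def sum_distrib_left mult_ac)
  have t3: "transpose (Y + Z) = transpose Y + transpose Z" "transpose (r *\<^sub>R Y) = r *\<^sub>R transpose Y"
    for Y Z :: "real^'a^'a" and r
    by (simp_all add: transpose_def vec_eq_iff)
  have t0: "transpose (0::real^'a^'a) = 0" by (simp add: transpose_def vec_eq_iff)
  note l = t1 t2 t3 matrix_vector_right_distrib matrix_vector_mult_scaleR inner_add_right
     bordered_add bordered_scaleR scaleR_add_left scaleR_add_right sum.distrib scaleR_sum_right
  show ?thesis
    unfolding is_sdp_def Omega_sdp_def
    by (auto simp: tr tH tY t0 assms linear_iff l field_simps)
qed

definition optimize_coord :: "sense \<Rightarrow> 'n::finite \<Rightarrow> 'n program \<Rightarrow> 'n program" where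
  "optimize_coord s i P = P\<lparr>sense := s, objective := (\<lambda>(y, Y, z). y $ i)\<rparr>"

definition fix_coord :: "'n::finite \<Rightarrow> real \<Rightarrow> 'n program \<Rightarrow> 'n program" where
  "fix_coord i t P = P\<lparr>equalities := insert (\<lambda>(y, Y, z). y $ i, t) (equalities P)\<rparr>"

(* The usual conventions for the empty set: its infimum is \<infinity>, its supremum -\<infinity>. *)
fun infimum_of :: "answer \<Rightarrow> ereal" where
  "infimum_of Infeasible = \<infinity>"
| "infimum_of Unbounded = - \<infinity>"
| "infimum_of (Optimal v) = ereal v"

fun supremum_of :: "answer \<Rightarrow> ereal" where
  "supremum_of Infeasible = - \<infinity>"
| "supremum_of Unbounded = \<infinity>"
| "supremum_of (Optimal v) = ereal v"

definition candidates :: "ereal \<Rightarrow> ereal \<Rightarrow> real set" where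
  "candidates l u = {t. if l = u then ereal t = l else l < ereal t \<and> ereal t < u}"

(* P describes the current set S_i; x collects the coordinates fixed so far. *)
primrec choose_coords ::
    "'n::finite list \<Rightarrow> 'n program \<Rightarrow> real^'n \<Rightarrow> ('n program, answer, real^'n) comp" where
  "choose_coords [] P x = Return x"
| "choose_coords (i # is) P x =
     Call (optimize_coord Maximize i P) (\<lambda>sup_ans.
     Call (optimize_coord Minimize i P) (\<lambda>inf_ans.
     Choose (candidates (infimum_of inf_ans) (supremum_of sup_ans)) (\<lambda>t.
     choose_coords is (fix_coord i t P) (\<chi> j. if j = i then t else x $ j))))"

definition find_relint_point ::
    "('n::{finite,linorder} \<Rightarrow> 'n sqmat) \<Rightarrow> 'n sqmat \<Rightarrow> (real, 'n) vec
      \<Rightarrow> ('n program, answer, (real, 'n) vec) comp" where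
  "find_relint_point H Q b = choose_coords (sorted_list_of_set UNIV) (Omega_sdp H Q b) 0"

definition passes_test :: "('n \<Rightarrow> real^'n^'n) \<Rightarrow> real^'n^'n \<Rightarrow> real^'n \<Rightarrow> real^'n \<Rightarrow> bool" where
  "passes_test H Q b x \<longleftrightarrow>
     gradient (cubic H Q b) x = 0 \<and>
     psd (hessian (cubic H Q b) x) \<and>
     (\<forall>d. hessian (cubic H Q b) x *v d = 0 \<longrightarrow> gradient (cubic_part H) d = 0)"

datatype 'n verdict = LocalMinimum "real^'n" | NoLocalMinimum

definition algorithm ::
    "('n::{finite,linorder} \<Rightarrow> 'n sqmat) \<Rightarrow> 'n sqmat \<Rightarrow> (real, 'n) vec
      \<Rightarrow> ('n program, answer, 'n verdict) comp" where
  "algorithm H Q b =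
     Call (Omega_sdp H Q b) (\<lambda>ans.
       if ans = Infeasible then Return NoLocalMinimum
       else bind (find_relint_point H Q b) (\<lambda>x.
         Return (if passes_test H Q b x then LocalMinimum x else NoLocalMinimum)))"

end

(* Omega is exactly the set of second-order points of p (points with vanishing gradient and positive
   semidefinite Hessian), whether or not p has a local minimum: the linear constraints force
   complementarity of the two semidefinite blocks, and this makes the gradient vanish at y.
   A second-order point is a local minimum iff the gradient of p_3 vanishes on the kernel of the
   Hessian.  The Hessian of a cubic is affine and is positive semidefinite on the convex set Omega,
   so its kernel at a relative interior point is contained in its kernel at every point of Omega.
   Hence, if p has a local minimum, every relative interior point of Omega is one.  Slicing a convex
   set at a relative interior value of a coordinate preserves relative interior points, so fixing the
   coordinates one after the other ends in the relative interior of Omega. *)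
theory Submission
  imports Defs
begin

section \<open>Positive semidefinite matrices\<close>

definition outer :: "real^'n \<Rightarrow> real^'n^'n" where
  "outer w = (\<chi> i j. w $ i * w $ j)"

lemma transpose_outer [simp]: "transpose (outer w) = outer w"
  by (simp add: outer_def transpose_def vec_eq_iff)

lemma outer_mult_vec: "outer w *v u = (w \<bullet> u) *\<^sub>R w"
  by (simp add: outer_def matrix_vector_mult_def inner_vec_def vec_eq_iff sum_distrib_left
      sum_distrib_right mult_ac)

lemma trace_mult_outer: "trace (M ** outer w) = w \<bullet> (M *v w)"
  by (simp add: outer_def trace_def matrix_matrix_mult_def matrix_vector_mult_def inner_vec_def
      sum_distrib_left mult_ac)

lemma trace_mult_add_left:
  fixes A B C :: "real^'m^'m"
  shows "trace ((A + B) ** C) = trace (A ** C) + trace (B ** C)"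
  by (simp add: trace_def matrix_matrix_mult_def distrib_right sum.distrib)

lemma inner_symmetric_matrix:
  fixes M :: "real^'n^'n"
  assumes "transpose M = M"
  shows "u \<bullet> (M *v v) = v \<bullet> (M *v u)"
  using dot_lmul_matrix[of u M v] assms
  by (metis inner_commute transpose_matrix_vector)

lemma quadratic_form_add_scaleR:
  fixes M :: "real^'n^'n"
  assumes "transpose M = M"
  shows "(u + t *\<^sub>R v) \<bullet> (M *v (u + t *\<^sub>R v)) =
    u \<bullet> (M *v u) + 2 * t * (v \<bullet> (M *v u)) + t\<^sup>2 * (v \<bullet> (M *v v))"
  using inner_symmetric_matrix[OF assms, of u v]
  by (simp add: matrix_vector_right_distrib matrix_vector_mult_scaleR inner_add_left
      inner_add_right power2_eq_square algebra_simps)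

text \<open>For \<open>t > 0\<close> the factor \<open>t ^ k\<close> can be cancelled, and
  nonnegativity survives the limit from the right. This reads off the sign of a leading coefficient,
  whatever the parity of \<open>k\<close>.\<close>

lemma nonneg_at_zero:
  fixes h :: "real \<Rightarrow> real"
  assumes "isCont h 0" and "eventually (\<lambda>t. 0 \<le> t ^ k * h t) (at_right 0)"
  shows "0 \<le> h 0"
proof (rule tendsto_lowerbound)
  show "(h \<longlongrightarrow> h 0) (at_right 0)"
    using assms(1) unfolding isCont_def by (rule filterlim_mono) (simp_all add: at_within_le_at)
  show "eventually (\<lambda>t. 0 \<le> h t) (at_right 0)"
    using assms(2) eventually_at_right_less[of 0]
    by eventually_elim (meson zero_le_mult_iff zero_less_power not_less)
qed simp

lemma eq_0_if_inner_nonneg: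
  fixes g :: "'a::real_inner"
  assumes "\<And>d. 0 \<le> g \<bullet> d"
  shows "g = 0"
  by (metis assms inner_eq_zero_iff inner_ge_zero inner_minus_right neg_0_le_iff_le order_antisym)

text \<open>A zero of a nonnegative function is a minimiser, so the gradient there, which is twice
  \<open>M *v y + w\<close>, must vanish.\<close>

lemma nonneg_quadratic_stationary:
  fixes M :: "real^'n^'n"
  assumes "transpose M = M" and nonneg: "\<And>u. 0 \<le> u \<bullet> (M *v u) + 2 * (w \<bullet> u) + s"
    and zero: "y \<bullet> (M *v y) + 2 * (w \<bullet> y) + s = 0"
  shows "M *v y + w = 0"
proof (rule eq_0_if_inner_nonneg)
  fix d
  \<comment> \<open>\<open>h t\<close> is the value at \<open>y + t *\<^sub>R d\<close> divided by
    \<open>t\<close>; \<open>h 0\<close> is the directional derivative.\<close>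
  define h where "h t = 2 * ((M *v y + w) \<bullet> d) + t * (d \<bullet> (M *v d))" for t
  have "t ^ 1 * h t = (y + t *\<^sub>R d) \<bullet> (M *v (y + t *\<^sub>R d)) + 2 * (w \<bullet> (y + t *\<^sub>R d)) + s" for t
    unfolding h_def quadratic_form_add_scaleR[OF assms(1)] using zero
    by (simp add: inner_add_left inner_add_right inner_commute power2_eq_square algebra_simps)
  then have "0 \<le> t ^ 1 * h t" for t
    using nonneg by simp
  moreover have "isCont h 0"
    unfolding h_def by (intro continuous_intros)
  ultimately show "0 \<le> (M *v y + w) \<bullet> d"
    using nonneg_at_zero[of h 1] by (simp add: h_def)
qed

lemma psd_kernel:
  assumes "psd M" and "v \<bullet> (M *v v) = 0"
  shows "M *v v = 0"
  using nonneg_quadratic_stationary[of M 0 0 v] assms by (simp add: psd_def)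

text \<open>One Cholesky step: the difference is a Schur complement, bordered by zeros in row and
  column \<open>i\<close>.\<close>

lemma psd_remove_pivot:
  fixes W :: "real^'n^'n"
  assumes "psd W" and pos: "0 < W $ i $ i"
  shows "psd (W - outer ((1 / sqrt (W $ i $ i)) *\<^sub>R column i W))" (is "psd (W - outer ?w)")
proof -
  have tr: "transpose W = W" and nonneg: "\<And>v. 0 \<le> v \<bullet> (W *v v)"
    using assms(1) by (auto simp: psd_def)
  have col: "column i W = W *v axis i 1"
    by (simp add: matrix_vector_mul_component vec_eq_iff column_def matrix_vector_mult_def
        axis_def if_distrib cong: if_cong)
  have "0 \<le> v \<bullet> ((W - outer ?w) *v v)" for v
  proof -
    define a where "a = axis i 1 \<bullet> (W *v v)"
    have ii: "axis i 1 \<bullet> (W *v axis i 1) = W $ i $ i"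
      by (simp add: col[symmetric] inner_axis' column_def)
    have wv: "?w \<bullet> v = a / sqrt (W $ i $ i)"
      unfolding col a_def using inner_symmetric_matrix[OF tr, of v "axis i 1"]
      by (simp add: inner_commute)
    have "0 \<le> (v + (- a / W $ i $ i) *\<^sub>R axis i 1) \<bullet> (W *v (v + (- a / W $ i $ i) *\<^sub>R axis i 1))"
      by (rule nonneg)
    also have "\<dots> = v \<bullet> (W *v v) - a\<^sup>2 / W $ i $ i"
      unfolding quadratic_form_add_scaleR[OF tr] ii a_def[symmetric] using pos
      by (simp add: field_simps power2_eq_square)
    also have "\<dots> = v \<bullet> (W *v v) - (?w \<bullet> v)\<^sup>2"
      unfolding wv using pos by (simp add: power_divide)
    also have "\<dots> = v \<bullet> ((W - outer ?w) *v v)"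
      by (simp add: matrix_vector_mult_diff_rdistrib outer_mult_vec inner_diff_right
          power2_eq_square inner_commute)
    finally show ?thesis .
  qed
  moreover have "transpose (W - outer ?w) = W - outer ?w"
    using tr transpose_outer[of ?w] by (simp add: transpose_def vec_eq_iff)
  ultimately show ?thesis
    by (simp add: psd_def)
qed

text \<open>A diagonal entry is the form at a unit vector. If it is zero, \<open>psd_kernel\<close>
  puts that vector into the kernel, which kills the column and, by symmetry, the row.\<close>

lemma psd_diagonal:
  assumes "psd W"
  shows "0 \<le> W $ i $ i" and "W $ i $ i = 0 \<Longrightarrow> W $ i $ j = 0 \<and> W $ j $ i = 0"
proof -
  have tr: "transpose W = W"
    using assms by (simp add: psd_def)
  have col: "(W *v axis i 1) $ j = W $ j $ i" for i j
    by (simp add: matrix_vector_mult_def axis_def if_distrib cong: if_cong)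
  have eq: "axis i 1 \<bullet> (W *v axis i 1) = W $ i $ i"
    by (simp add: inner_axis' col)
  show "0 \<le> W $ i $ i"
    using assms eq by (metis psd_def)
  show "W $ i $ i = 0 \<Longrightarrow> W $ i $ j = 0 \<and> W $ j $ i = 0"
    using psd_kernel[OF assms, of "axis i 1"] eq col[of i j] tr
    by (metis transpose_def vec_lambda_beta zero_index)
qed

text \<open>Eliminating the nonzero pivots of \<open>W\<close> one at a time (Cholesky) writes \<open>W\<close> as a sum of
  matrices \<open>w w\<^sup>T\<close>; no spectral theorem is needed.\<close>

lemma trace_mult_psd_nonneg:
  fixes M W :: "real^'n^'n"
  assumes M: "psd M" and "psd W"
  shows "0 \<le> trace (M ** W)"
  using assms(2)
proof (induction "card {i. W $ i $ i \<noteq> 0}" arbitrary: W rule: less_induct)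
  case less
  show ?case
  proof (cases "\<exists>i. W $ i $ i \<noteq> 0")
    case False
    then have "W $ i $ j = 0" for i j
      using psd_diagonal(2)[OF less.prems, of i j] by blast
    then show ?thesis
      by (simp add: trace_def matrix_matrix_mult_def)
  next
    case True
    then obtain i where i: "W $ i $ i \<noteq> 0" by blast
    then have pos: "0 < W $ i $ i"
      using psd_diagonal(1)[OF less.prems, of i] by simp
    define w where "w = (1 / sqrt (W $ i $ i)) *\<^sub>R column i W"
    have psd: "psd (W - outer w)"
      unfolding w_def by (rule psd_remove_pivot[OF less.prems pos])
    have "(W - outer w) $ i $ i = 0"
      using pos by (simp add: w_def outer_def column_def field_simps)
    \<comment> \<open>Zero pivots stay zero, so the number of nonzero pivots strictly drops.\<close>
    moreover have "(W - outer w) $ j $ j = 0" if "W $ j $ j = 0" for j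
      using psd_diagonal(2)[OF less.prems that, of i] that
      by (simp add: w_def outer_def column_def)
    ultimately have "{j. (W - outer w) $ j $ j \<noteq> 0} \<subset> {j. W $ j $ j \<noteq> 0}"
      using i by blast
    then have "0 \<le> trace (M ** (W - outer w))"
      using less.hyps psd by (simp add: psubset_card_mono)
    moreover have "trace (M ** W) = trace (M ** (W - outer w)) + trace (M ** outer w)"
      using matrix_add_ldistrib[of M "W - outer w" "outer w"] by (simp add: trace_add)
    moreover have "0 \<le> trace (M ** outer w)"
      using M by (simp add: trace_mult_outer psd_def)
    ultimately show ?thesis
      by simp
  qed
qed

text \<open>A vector indexed by \<open>'n option\<close> splits into its first block
  \<open>u\<close> and its last entry \<open>c\<close>; expanding the form in these gives the
  right-hand side.\<close>

lemma psd_bordered_iff: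
  "psd (bordered M w s) \<longleftrightarrow>
    transpose M = M \<and> (\<forall>u c. 0 \<le> u \<bullet> (M *v u) + 2 * c * (w \<bullet> u) + c\<^sup>2 * s)"
proof -
  define vec where "vec u c = (\<chi> r. case r of Some i \<Rightarrow> u $ i | None \<Rightarrow> c)"
    for u :: "real^'a" and c :: real
  have sum_option: "(\<Sum>r\<in>UNIV. f r) = f None + (\<Sum>i\<in>UNIV. f (Some i))" for f :: "'a option \<Rightarrow> real"
    by (simp add: UNIV_option_conv sum.reindex)
  have quad: "vec u c \<bullet> (bordered M w s *v vec u c) =
      u \<bullet> (M *v u) + 2 * c * (w \<bullet> u) + c\<^sup>2 * s" for u c
    by (simp add: inner_vec_def matrix_vector_mult_def bordered_def vec_def sum_option
        algebra_simps sum.distrib sum_distrib_left power2_eq_square)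
  have "\<exists>u c. v = vec u c" for v
    by (rule exI[of _ "\<chi> i. v $ Some i"], rule exI[of _ "v $ None"])
      (auto simp: vec_def vec_eq_iff split: option.splits)
  then have "(\<forall>v. 0 \<le> v \<bullet> (bordered M w s *v v)) \<longleftrightarrow>
      (\<forall>u c. 0 \<le> u \<bullet> (M *v u) + 2 * c * (w \<bullet> u) + c\<^sup>2 * s)"
    using quad by metis
  moreover have "transpose (bordered M w s) = bordered M w s \<longleftrightarrow> transpose M = M"
    by (auto simp: bordered_def transpose_def vec_eq_iff split: option.splits)
  ultimately show ?thesis
    by (simp add: psd_def)
qed

lemma psd_convex_combination:
  assumes "psd A" and "psd B" and "0 \<le> s" and "0 \<le> t"
  shows "psd (s *\<^sub>R A + t *\<^sub>R B)"
proof -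
  have "transpose (s *\<^sub>R A + t *\<^sub>R B) = s *\<^sub>R A + t *\<^sub>R B"
    using assms(1,2) by (simp add: psd_def transpose_def vec_eq_iff)
  moreover have "0 \<le> v \<bullet> ((s *\<^sub>R A + t *\<^sub>R B) *v v)" for v
    using assms by (simp add: psd_def matrix_vector_mult_add_rdistrib inner_add_right
        scaleR_matrix_vector_assoc[symmetric])
  ultimately show ?thesis
    by (simp add: psd_def)
qed

text \<open>The form of the combination at \<open>v\<close> is a sum of two nonnegative terms equal
  to zero, so the term with weight \<open>s > 0\<close> vanishes and \<open>psd_kernel\<close>
  applies.\<close>

lemma psd_combination_kernel:
  assumes "psd A" and "psd B" and "0 < s" and "0 \<le> t" and "(s *\<^sub>R A + t *\<^sub>R B) *v v = 0"
  shows "A *v v = 0"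
proof -
  have "s * (v \<bullet> (A *v v)) + t * (v \<bullet> (B *v v)) = 0"
    using arg_cong[OF assms(5), of "inner v"]
    by (simp add: matrix_vector_mult_add_rdistrib inner_add_right scaleR_matrix_vector_assoc[symmetric])
  moreover have "0 \<le> s * (v \<bullet> (A *v v))" "0 \<le> t * (v \<bullet> (B *v v))"
    using assms by (simp_all add: psd_def)
  ultimately have "v \<bullet> (A *v v) = 0"
    using assms(3) by (simp add: add_nonneg_eq_0_iff)
  then show ?thesis
    by (rule psd_kernel[OF assms(1)])
qed

text \<open>On the orthogonal complement of the kernel the form is strictly positive off zero. Its
  minimum over the compact unit sphere of that complement serves as \<open>l\<close>, and
  homogeneity extends the bound.\<close>

lemma psd_coercive:
  fixes M :: "real^'n^'n"
  assumes "psd M"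
  obtains l where "0 < l"
    and "\<And>r. (\<And>v. M *v v = 0 \<Longrightarrow> r \<bullet> v = 0) \<Longrightarrow> l * (norm r)\<^sup>2 \<le> r \<bullet> (M *v r)"
proof -
  define N where "N = {r. \<forall>v. M *v v = 0 \<longrightarrow> r \<bullet> v = 0}"
  define S where "S = sphere 0 1 \<inter> N"
  have "N = (\<Inter>v\<in>{v. M *v v = 0}. {r. r \<bullet> v = 0})"
    by (auto simp: N_def)
  then have "closed N"
    by (auto intro!: closed_INT closed_Collect_eq continuous_intros)
  then have "compact S"
    by (auto simp: S_def)
  have pos: "0 < r \<bullet> (M *v r)" if "r \<in> S" for r
  proof -
    have "r \<bullet> (M *v r) \<noteq> 0"
    proof
      assume "r \<bullet> (M *v r) = 0"
      then have "M *v r = 0"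
        by (rule psd_kernel[OF assms])
      then have "r \<bullet> r = 0"
        using that by (simp add: S_def N_def)
      then show False
        using that by (simp add: S_def)
    qed
    then show ?thesis
      using assms by (metis psd_def order_le_less)
  qed
  obtain l where l: "0 < l" "\<And>r. r \<in> S \<Longrightarrow> l \<le> r \<bullet> (M *v r)"
  proof (cases "S = {}")
    \<comment> \<open>Here the complement of the kernel is trivial, so any positive constant
      works.\<close>
    case True
    then show ?thesis
      using that[of 1] by simp
  next
    case False
    have "continuous_on S (\<lambda>r. r \<bullet> (M *v r))"
      by (intro continuous_intros)
    then obtain r0 where "r0 \<in> S" "\<And>r. r \<in> S \<Longrightarrow> r0 \<bullet> (M *v r0) \<le> r \<bullet> (M *v r)"
      using continuous_attains_inf[OF \<open>compact S\<close> False] by blast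
    then show ?thesis
      using that pos by blast
  qed
  show ?thesis
  proof (rule that[OF l(1)])
    fix r assume r: "\<And>v. M *v v = 0 \<Longrightarrow> r \<bullet> v = 0"
    show "l * (norm r)\<^sup>2 \<le> r \<bullet> (M *v r)"
    proof (cases "r = 0")
      case False
      define r' where "r' = (1 / norm r) *\<^sub>R r"
      have "r' \<in> S"
        using False r by (simp add: S_def N_def r'_def)
      then have "l \<le> r' \<bullet> (M *v r')"
        by (rule l(2))
      also have "\<dots> = (r \<bullet> (M *v r)) / (norm r)\<^sup>2"
        by (simp add: r'_def matrix_vector_mult_scaleR power2_eq_square)
      finally show ?thesis
        using False by (simp add: field_simps)
    qed simp
  qed
qed

section \<open>Local minima of cubic polynomials\<close>

text \<open>The symmetric 3-tensor with slices \<open>H i\<close>, contracted with \<open>x\<close>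
  in one slot; for symmetric data this is the Hessian of \<open>cubic_part H\<close> at
  \<open>x\<close>.\<close>

definition contract :: "('n \<Rightarrow> real^'n^'n) \<Rightarrow> real^'n \<Rightarrow> real^'n^'n" where
  "contract H x = (\<Sum>i\<in>UNIV. x $ i *\<^sub>R H i)"

lemma matrix_vector_mult_sum_left:
  fixes A :: "'i \<Rightarrow> real^'n^'m"
  shows "(\<Sum>i\<in>S. A i) *v x = (\<Sum>i\<in>S. A i *v x)"
  by (induction S rule: infinite_finite_induct) (simp_all add: matrix_vector_mult_add_rdistrib)

lemma contract_add: "contract H (x + y) = contract H x + contract H y"
  by (simp add: contract_def scaleR_add_left sum.distrib)

lemma contract_scaleR: "contract H (r *\<^sub>R x) = r *\<^sub>R contract H x"
  by (simp add: contract_def scaleR_sum_right)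

lemma contract_mult_vec: "contract H x *v y = (\<Sum>i\<in>UNIV. x $ i *\<^sub>R (H i *v y))"
  by (simp add: contract_def matrix_vector_mult_sum_left scaleR_matrix_vector_assoc[symmetric])

text \<open>Feeds the product rule for derivatives and the norm bound \<open>K\<close> in
  \<open>third_order_imp_local_minimum\<close>.\<close>

lemma bilinear_contract: "bilinear (\<lambda>x y. contract H x *v y)"
  unfolding bilinear_def
  by (auto intro!: linearI simp: contract_add contract_scaleR matrix_vector_right_distrib
      matrix_vector_mult_scaleR matrix_vector_mult_add_rdistrib scaleR_matrix_vector_assoc[symmetric])

lemma cubic_part_contract: "cubic_part H x = 1/6 * (x \<bullet> (contract H x *v x))"
  by (simp add: cubic_part_def contract_def matrix_vector_mult_sum_left inner_sum_right)

text \<open>Swapping the first two indices and swapping the last two generate all permutations of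
  three indices, so the tensor is fully symmetric.\<close>

locale symmetric_cubic =
  fixes H :: "'n::finite \<Rightarrow> real^'n^'n" and Q :: "real^'n^'n" and b :: "real^'n"
  assumes transpose_H: "\<And>i. transpose (H i) = H i"
    and transpose_Q: "transpose Q = Q"
    and H_swap: "\<And>i j k. H i $ j $ k = H j $ i $ k"
begin

definition grad :: "real^'n \<Rightarrow> real^'n" where
  "grad x = (1/2) *\<^sub>R (contract H x *v x) + Q *v x + b"

definition hess :: "real^'n \<Rightarrow> real^'n^'n" where
  "hess x = contract H x + Q"

lemma transpose_contract: "transpose (contract H x) = contract H x"
  using transpose_H by (simp add: contract_def transpose_def vec_eq_iff)

lemma transpose_hess: "transpose (hess x) = hess x"
  using transpose_contract[of x] transpose_Q by (simp add: hess_def transpose_def vec_eq_iff)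

lemma H_swap': "H i $ k $ j = H j $ k $ i"
  using transpose_H H_swap by (metis transpose_def vec_lambda_beta)

lemma contract_commute: "contract H x *v y = contract H y *v x"
proof -
  have "(\<Sum>i\<in>UNIV. x $ i * (\<Sum>j\<in>UNIV. H i $ k $ j * y $ j)) =
      (\<Sum>i\<in>UNIV. y $ i * (\<Sum>j\<in>UNIV. H i $ k $ j * x $ j))" for k
    unfolding sum_distrib_left
    by (subst sum.swap) (intro sum.cong refl, simp add: H_swap' mult_ac)
  then show ?thesis
    unfolding contract_mult_vec by (simp add: vec_eq_iff matrix_vector_mult_def)
qed

lemma contract_inner_swap: "u \<bullet> (contract H x *v y) = y \<bullet> (contract H x *v u)"
  by (rule inner_symmetric_matrix[OF transpose_contract])

text \<open>Moves the free index of the contraction onto \<open>H i\<close>; this matches the traces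
  in \<open>Omega\<close> with the components of the gradient.\<close>

lemma contract_nth: "(contract H x *v y) $ i = x \<bullet> (H i *v y)"
proof -
  have "axis i 1 \<bullet> (contract H x *v y) = x \<bullet> (contract H (axis i 1) *v y)"
    using contract_inner_swap contract_commute by metis
  moreover have "contract H (axis i 1) = H i"
    by (simp add: contract_def axis_def if_distrib[of "\<lambda>r. r *\<^sub>R _"] cong: if_cong)
  ultimately show ?thesis
    by (simp add: inner_axis')
qed

lemma hess_mult_vec: "hess x *v v = contract H x *v v + Q *v v"
  by (simp add: hess_def matrix_vector_mult_add_rdistrib)

section \<open>Gradient and Hessian of the cubic\<close>

lemma has_derivative_contract:
  "((\<lambda>x. contract H x *v x) has_derivative (\<lambda>d. 2 *\<^sub>R (contract H x *v d))) (at x)"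
proof -
  have "bounded_bilinear (\<lambda>x y. contract H x *v y)"
    using bilinear_contract bilinear_conv_bounded_bilinear by blast
  from bounded_bilinear.FDERIV[OF this has_derivative_ident has_derivative_ident, of x UNIV]
  show ?thesis
    using contract_commute[of _ x] by (simp add: scaleR_2)
qed

lemma has_derivative_cubic_part:
  "(cubic_part H has_derivative (\<lambda>d. ((1/2) *\<^sub>R (contract H x *v x)) \<bullet> d)) (at x)"
proof -
  have "((\<lambda>x. 1/6 * (x \<bullet> (contract H x *v x))) has_derivative
      (\<lambda>d. 1/6 * (x \<bullet> (2 *\<^sub>R (contract H x *v d)) + d \<bullet> (contract H x *v x)))) (at x)"
    by (intro has_derivative_mult_right has_derivative_inner has_derivative_ident
        has_derivative_contract)
  moreover have "(\<lambda>d. 1/6 * (x \<bullet> (2 *\<^sub>R (contract H x *v d)) + d \<bullet> (contract H x *v x))) =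
      (\<lambda>d. ((1/2) *\<^sub>R (contract H x *v x)) \<bullet> d)"
    using contract_inner_swap[of x x] by (simp add: inner_commute[of "contract H x *v x"])
  ultimately show ?thesis
    unfolding cubic_part_contract[abs_def] by (simp only:)
qed

lemma has_derivative_cubic: "(cubic H Q b has_derivative (\<lambda>d. grad x \<bullet> d)) (at x)"
proof -
  have "((\<lambda>x. cubic_part H x + 1/2 * (x \<bullet> (Q *v x)) + b \<bullet> x) has_derivative
      (\<lambda>d. ((1/2) *\<^sub>R (contract H x *v x)) \<bullet> d + 1/2 * (x \<bullet> (Q *v d) + d \<bullet> (Q *v x)) + b \<bullet> d)) (at x)"
    by (intro has_derivative_add has_derivative_mult_right has_derivative_inner
        has_derivative_ident has_derivative_cubic_part bounded_linear_imp_has_derivative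
        matrix_vector_mul_bounded_linear bounded_linear_inner_right)
  moreover have "(\<lambda>d. ((1/2) *\<^sub>R (contract H x *v x)) \<bullet> d + 1/2 * (x \<bullet> (Q *v d) + d \<bullet> (Q *v x)) + b \<bullet> d) =
      (\<lambda>d. grad x \<bullet> d)"
    using inner_symmetric_matrix[OF transpose_Q, of x]
    by (simp add: grad_def inner_add_left inner_commute[of "contract H x *v x"]
        inner_commute[of "Q *v x"] fun_eq_iff)
  ultimately show ?thesis
    unfolding cubic_def[abs_def] by (simp only:)
qed

lemma has_derivative_grad: "(grad has_derivative (\<lambda>d. hess x *v d)) (at x)"
proof -
  have "((\<lambda>x. (1/2) *\<^sub>R (contract H x *v x) + Q *v x + b) has_derivative
      (\<lambda>d. (1/2) *\<^sub>R (2 *\<^sub>R (contract H x *v d)) + Q *v d + 0)) (at x)"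
    by (intro has_derivative_add has_derivative_scaleR_right has_derivative_contract
        bounded_linear_imp_has_derivative matrix_vector_mul_bounded_linear has_derivative_const)
  then show ?thesis
    by (simp add: grad_def[abs_def] hess_mult_vec)
qed

lemma gradient_eqI:
  assumes "(f has_derivative (\<lambda>d. g \<bullet> d)) (at x)"
  shows "gradient f x = g"
  using frechet_derivative_at[OF assms, symmetric]
  by (simp add: gradient_def vec_eq_iff inner_axis)

lemma gradient_cubic: "gradient (cubic H Q b) x = grad x"
  by (rule gradient_eqI[OF has_derivative_cubic])

lemma gradient_cubic_part: "gradient (cubic_part H) x = (1/2) *\<^sub>R (contract H x *v x)"
  by (rule gradient_eqI[OF has_derivative_cubic_part])

lemma hessian_cubic: "hessian (cubic H Q b) x = hess x"
proof -
  have "gradient (cubic H Q b) = grad"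
    using gradient_cubic by blast
  then show ?thesis
    using frechet_derivative_at[OF has_derivative_grad, symmetric]
    by (simp add: hessian_def matrix_of_matrix_vector_mul)
qed

section \<open>Taylor expansion\<close>

lemma cubic_part_add:
  "cubic_part H (x + d) = cubic_part H x + 1/2 * ((contract H x *v x) \<bullet> d) +
     1/2 * (x \<bullet> (contract H d *v d)) + cubic_part H d"
proof -
  have "x \<bullet> (contract H x *v d) = (contract H x *v x) \<bullet> d" "x \<bullet> (contract H d *v x) = (contract H x *v x) \<bullet> d"
    "d \<bullet> (contract H x *v x) = (contract H x *v x) \<bullet> d"
    "d \<bullet> (contract H x *v d) = x \<bullet> (contract H d *v d)" "d \<bullet> (contract H d *v x) = x \<bullet> (contract H d *v d)"
    by (metis contract_inner_swap contract_commute inner_commute)+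
  then show ?thesis
    by (simp add: cubic_part_contract contract_add matrix_vector_right_distrib
        matrix_vector_mult_add_rdistrib inner_add_left inner_add_right algebra_simps)
qed

lemma cubic_part_scaleR: "cubic_part H (t *\<^sub>R x) = t ^ 3 * cubic_part H x"
  by (simp add: cubic_part_contract contract_scaleR matrix_vector_mult_scaleR
      scaleR_matrix_vector_assoc[symmetric] power3_eq_cube)

text \<open>The expansion is exact: the third derivative is constant, so the remainder is
  \<open>cubic_part H d\<close>. All local arguments below compare its terms.\<close>

lemma cubic_add:
  "cubic H Q b (x + d) = cubic H Q b x + grad x \<bullet> d + 1/2 * (d \<bullet> (hess x *v d)) + cubic_part H d"
proof -
  have "x \<bullet> (Q *v d) = (Q *v x) \<bullet> d" "d \<bullet> (Q *v x) = (Q *v x) \<bullet> d"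
    using inner_symmetric_matrix[OF transpose_Q, of x d] by (simp_all add: inner_commute)
  moreover have "x \<bullet> (contract H d *v d) = d \<bullet> (contract H x *v d)"
    by (metis contract_inner_swap contract_commute)
  ultimately show ?thesis
    unfolding cubic_def cubic_part_add grad_def hess_mult_vec
    by (simp add: matrix_vector_right_distrib inner_add_left inner_add_right) (simp add: field_simps)
qed

section \<open>Necessary and sufficient conditions for a local minimum\<close>

definition second_order_points :: "(real^'n) set" where
  "second_order_points = {x. grad x = 0 \<and> psd (hess x)}"

definition third_order_condition :: "real^'n \<Rightarrow> bool" where
  "third_order_condition x \<longleftrightarrow> (\<forall>d. hess x *v d = 0 \<longrightarrow> contract H d *v d = 0)"

lemma passes_test_iff:
  "passes_test H Q b x \<longleftrightarrow> x \<in> second_order_points \<and> third_order_condition x"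
  by (simp add: passes_test_def gradient_cubic hessian_cubic gradient_cubic_part
      second_order_points_def third_order_condition_def conj_assoc)

text \<open>Near \<open>t = 0\<close> the curve stays in the ball of minimality, so
  \<open>t ^ k * h t\<close> is nonnegative for small \<open>t > 0\<close> and
  \<open>nonneg_at_zero\<close> applies. Curves are allowed because the third-order condition is
  invisible along straight lines.\<close>

lemma local_minimum_along_curve:
  assumes "local_minimum (cubic H Q b) x" and "isCont c 0" and "c 0 = 0" and "isCont h 0"
    and eq: "\<And>t. cubic H Q b (x + c t) = cubic H Q b x + t ^ k * h t"
  shows "0 \<le> h 0"
proof -
  obtain e where e: "0 < e" "\<And>y. norm (y - x) \<le> e \<Longrightarrow> cubic H Q b x \<le> cubic H Q b y"
    using assms(1) unfolding local_minimum_def by blast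
  have "(c \<longlongrightarrow> 0) (at_right 0)"
    using assms(2) unfolding isCont_def assms(3) by (rule filterlim_mono) (simp_all add: at_within_le_at)
  then have "eventually (\<lambda>t. norm (c t) < e) (at_right 0)"
    using e(1) by (simp add: tendsto_iff)
  then have "eventually (\<lambda>t. 0 \<le> t ^ k * h t) (at_right 0)"
  proof eventually_elim
    case (elim t)
    then show ?case
      using e(2)[of "x + c t"] by (simp add: eq)
  qed
  then show ?thesis
    using nonneg_at_zero assms(4) by blast
qed

lemma local_minimum_imp_grad:
  assumes "local_minimum (cubic H Q b) x"
  shows "grad x = 0"
proof (rule eq_0_if_inner_nonneg)
  fix d
  define h where "h t = grad x \<bullet> d + t * (1/2 * (d \<bullet> (hess x *v d))) + t\<^sup>2 * cubic_part H d" for t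
  have "0 \<le> h 0"
  proof (rule local_minimum_along_curve[OF assms, of "\<lambda>t. t *\<^sub>R d"])
    show "cubic H Q b (x + t *\<^sub>R d) = cubic H Q b x + t ^ 1 * h t" for t
      by (simp add: cubic_add cubic_part_scaleR matrix_vector_mult_scaleR h_def
          power2_eq_square power3_eq_cube algebra_simps)
  qed (auto simp: h_def intro!: continuous_intros)
  then show "0 \<le> grad x \<bullet> d"
    by (simp add: h_def)
qed

lemma local_minimum_imp_psd:
  assumes "local_minimum (cubic H Q b) x"
  shows "psd (hess x)"
proof -
  have "0 \<le> d \<bullet> (hess x *v d)" for d
  proof -
    define h where "h t = 1/2 * (d \<bullet> (hess x *v d)) + t * cubic_part H d" for t
    have "0 \<le> h 0"
    proof (rule local_minimum_along_curve[OF assms, of "\<lambda>t. t *\<^sub>R d"])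
      show "cubic H Q b (x + t *\<^sub>R d) = cubic H Q b x + t ^ 2 * h t" for t
        by (simp add: cubic_add local_minimum_imp_grad[OF assms] cubic_part_scaleR
            matrix_vector_mult_scaleR h_def power2_eq_square power3_eq_cube algebra_simps)
    qed (auto simp: h_def intro!: continuous_intros)
    then show ?thesis
      by (simp add: h_def)
  qed
  then show ?thesis
    by (simp add: psd_def transpose_hess)
qed

text \<open>Along a kernel direction the increment is exactly \<open>t ^ 3 * cubic_part H d\<close>,
  hence \<open>cubic_part H d\<close> is nonnegative. The kernel also contains \<open>- d\<close>,
  and the cubic part is odd.\<close>

lemma local_minimum_imp_cubic_part:
  assumes "local_minimum (cubic H Q b) x" and "hess x *v d = 0"
  shows "cubic_part H d = 0"
proof -
  have "0 \<le> cubic_part H d" if "hess x *v d = 0" for d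
  proof (rule local_minimum_along_curve[OF assms(1), of "\<lambda>t. t *\<^sub>R d" "\<lambda>_. cubic_part H d"])
    show "cubic H Q b (x + t *\<^sub>R d) = cubic H Q b x + t ^ 3 * cubic_part H d" for t
      by (simp add: cubic_add local_minimum_imp_grad[OF assms(1)] cubic_part_scaleR
          matrix_vector_mult_scaleR that)
  qed (auto intro!: continuous_intros)
  from this[of d] this[of "(- 1) *\<^sub>R d"] show ?thesis
    using assms(2) unfolding cubic_part_scaleR matrix_vector_mult_scaleR by simp
qed

text \<open>Along the curve \<open>x + t d + t\<^sup>2 e\<close> with \<open>d\<close> in the kernel of the Hessian, all terms of order
  less than 4 vanish, and the fourth-order coefficient contains \<open>\<nabla>p\<^sub>3(d) \<bullet> e\<close> linearly.\<close>

lemma local_minimum_imp_third_order: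
  assumes "local_minimum (cubic H Q b) x"
  shows "third_order_condition x"
  unfolding third_order_condition_def
proof (intro allI impI)
  fix d assume d: "hess x *v d = 0"
  have fourth: "0 \<le> 1/2 * (e \<bullet> (hess x *v e)) + 1/2 * ((contract H d *v d) \<bullet> e)" for e
  proof -
    define h where "h t = 1/2 * (e \<bullet> (hess x *v e)) + 1/2 * ((contract H d *v d) \<bullet> e) +
      t * (1/2 * (d \<bullet> (contract H e *v e))) + t\<^sup>2 * cubic_part H e" for t
    have "0 \<le> h 0"
    proof (rule local_minimum_along_curve[OF assms, of "\<lambda>t. t *\<^sub>R d + t\<^sup>2 *\<^sub>R e"])
      have "d \<bullet> (hess x *v e) = 0"
        using inner_symmetric_matrix[OF transpose_hess, of d x e] d by simp
      then show "cubic H Q b (x + (t *\<^sub>R d + t\<^sup>2 *\<^sub>R e)) = cubic H Q b x + t ^ 4 * h t" for t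
        by (simp add: cubic_add local_minimum_imp_grad[OF assms] cubic_part_add cubic_part_scaleR
            local_minimum_imp_cubic_part[OF assms d] matrix_vector_mult_scaleR d
            matrix_vector_right_distrib contract_scaleR scaleR_matrix_vector_assoc[symmetric]
            inner_add_left inner_add_right h_def power2_eq_square power3_eq_cube power4_eq_xxxx
            algebra_simps)
    qed (auto simp: h_def intro!: continuous_intros)
    then show ?thesis
      by (simp add: h_def)
  qed
  show "contract H d *v d = 0"
  proof (rule eq_0_if_inner_nonneg)
    fix e
    \<comment> \<open>\<open>s * h s\<close> is twice the inequality \<open>fourth\<close> at
      \<open>s *\<^sub>R e\<close>; for small \<open>s\<close> the part linear in \<open>e\<close>
      dominates.\<close>
    define h where "h s = (contract H d *v d) \<bullet> e + s * (e \<bullet> (hess x *v e))" for s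
    have "0 \<le> s ^ 1 * h s" for s
      using fourth[of "s *\<^sub>R e"] by (simp add: h_def matrix_vector_mult_scaleR algebra_simps)
    moreover have "isCont h 0"
      unfolding h_def by (intro continuous_intros)
    ultimately have "0 \<le> h 0"
      using nonneg_at_zero[of h 1] by simp
    then show "0 \<le> (contract H d *v d) \<bullet> e"
      by (simp add: h_def)
  qed
qed

text \<open>Split the displacement into a kernel part \<open>n\<close> and an orthogonal part
  \<open>r\<close>. The third-order condition leaves only cubic terms at least quadratic in
  \<open>r\<close>, and the coercive Hessian term absorbs these near \<open>x\<close>.\<close>

lemma third_order_imp_local_minimum:
  assumes "x \<in> second_order_points" and "third_order_condition x"
  shows "local_minimum (cubic H Q b) x"
proof -
  have grad: "grad x = 0" and psd: "psd (hess x)"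
    using assms(1) by (auto simp: second_order_points_def)
  define N where "N = {v. hess x *v v = 0}"
  have "subspace N"
    unfolding N_def subspace_def
    by (auto simp: matrix_vector_right_distrib matrix_vector_mult_scaleR)
  obtain l where l: "0 < l"
    "\<And>r. (\<And>v. hess x *v v = 0 \<Longrightarrow> r \<bullet> v = 0) \<Longrightarrow> l * (norm r)\<^sup>2 \<le> r \<bullet> (hess x *v r)"
    using psd_coercive[OF psd] by blast
  obtain K where K: "0 < K" "\<And>u v. norm (contract H u *v v) \<le> K * norm u * norm v"
    using bilinear_bounded_pos[OF bilinear_contract] by blast
  have bound: "\<bar>u \<bullet> (contract H r *v r)\<bar> \<le> K * norm u * (norm r)\<^sup>2" for u r
  proof -
    have "\<bar>u \<bullet> (contract H r *v r)\<bar> \<le> norm u * norm (contract H r *v r)"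
      by (rule Cauchy_Schwarz_ineq2)
    also have "\<dots> \<le> norm u * (K * norm r * norm r)"
      by (intro mult_left_mono K(2)) simp
    finally show ?thesis
      by (simp add: power2_eq_square mult_ac)
  qed
  \<comment> \<open>The radius makes \<open>K * norm u\<close> at most \<open>l / 2\<close> for
    \<open>u = n\<close> and \<open>u = r\<close>. The cubic terms then total at most
    \<open>l/4 + l/12 = l/3\<close> times \<open>(norm r)\<^sup>2\<close>, against at least
    \<open>l/2\<close> times it from the Hessian.\<close>
  have "cubic H Q b x \<le> cubic H Q b (x + d)" if d: "norm d \<le> l / (2 * K)" for d
  proof -
    obtain n r where n: "n \<in> N" and r: "\<And>w. w \<in> N \<Longrightarrow> orthogonal r w" and nr: "d = n + r"
      using orthogonal_subspace_decomp_exists[of N d] \<open>subspace N\<close>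
      by (metis span_eq_iff)
    have norms: "norm n \<le> norm d" "norm r \<le> norm d"
    proof -
      have "(norm d)\<^sup>2 = (norm n)\<^sup>2 + (norm r)\<^sup>2"
        unfolding nr using norm_add_Pythagorean r[OF n] orthogonal_commute by blast
      then show "norm n \<le> norm d" "norm r \<le> norm d"
        by (simp_all add: power2_le_imp_le)
    qed
    have kernel: "hess x *v n = 0" "contract H n *v n = 0"
      using n assms(2) by (auto simp: N_def third_order_condition_def)
    have "d \<bullet> (hess x *v d) = r \<bullet> (hess x *v r)"
      using inner_symmetric_matrix[OF transpose_hess, of n x r] kernel
      by (simp add: nr matrix_vector_right_distrib inner_add_left)
    moreover have "cubic_part H d = 1/2 * (n \<bullet> (contract H r *v r)) + 1/6 * (r \<bullet> (contract H r *v r))"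
      unfolding nr cubic_part_add using kernel by (simp add: cubic_part_contract)
    ultimately have eq: "cubic H Q b (x + d) - cubic H Q b x =
        1/2 * (r \<bullet> (hess x *v r)) + 1/2 * (n \<bullet> (contract H r *v r)) + 1/6 * (r \<bullet> (contract H r *v r))"
      by (simp add: cubic_add grad)
    have bd: "\<bar>u \<bullet> (contract H r *v r)\<bar> \<le> l / 2 * (norm r)\<^sup>2" if "norm u \<le> norm d" for u
    proof -
      have "K * norm u \<le> l / 2"
        using mult_left_mono[OF order_trans[OF that d], of K] K(1) by (simp add: divide_simps)
      then have "K * norm u * (norm r)\<^sup>2 \<le> l / 2 * (norm r)\<^sup>2"
        by (rule mult_right_mono) simp
      then show ?thesis
        using bound[of u r] by linarith
    qed
    have "l * (norm r)\<^sup>2 \<le> r \<bullet> (hess x *v r)"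
      using r by (intro l(2)) (auto simp: N_def orthogonal_def)
    moreover have "0 \<le> l * (norm r)\<^sup>2"
      using l(1) by simp
    ultimately show ?thesis
      using eq bd[OF norms(1)] bd[OF norms(2)] by linarith
  qed
  then show ?thesis
    unfolding local_minimum_def using l(1) K(1)
    by (intro exI[of _ "l / (2 * K)"]) (metis add.commute diff_add_cancel divide_pos_pos mult_pos_pos zero_less_numeral)
qed

lemma local_minimum_iff:
  "local_minimum (cubic H Q b) x \<longleftrightarrow> x \<in> second_order_points \<and> third_order_condition x"
proof
  assume *: "local_minimum (cubic H Q b) x"
  show "x \<in> second_order_points \<and> third_order_condition x"
    unfolding second_order_points_def
    using local_minimum_imp_grad[OF *] local_minimum_imp_psd[OF *] local_minimum_imp_third_order[OF *]
    by simp
qed (use third_order_imp_local_minimum in blast)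

section \<open>The set \<open>\<Omega>\<close> consists of the second-order points\<close>

lemma trace_contract: "trace (contract H y ** Y) = y \<bullet> (\<chi> i. trace (H i ** Y))"
proof -
  have "trace ((\<Sum>i\<in>S. y $ i *\<^sub>R H i) ** Y) = (\<Sum>i\<in>S. y $ i * trace (H i ** Y))" for S
  proof (induction S rule: infinite_finite_induct)
    case (insert i S)
    have "trace ((y $ i *\<^sub>R H i) ** Y) = y $ i * trace (H i ** Y)"
      by (simp add: trace_def matrix_matrix_mult_def sum_distrib_left mult_ac)
    with insert show ?case
      by (simp add: trace_mult_add_left)
  qed (simp_all add: trace_def matrix_matrix_mult_def)
  then show ?thesis
    by (simp add: contract_def inner_vec_def)
qed

text \<open>The witnesses are \<open>Y = outer y\<close> and
  \<open>z = y \<bullet> (hess y *v y)\<close>. The linear constraints become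
  \<open>y \<bullet> grad y = 0\<close> and the components of \<open>grad y = 0\<close>; the block
  forms become the Hessian form at \<open>u + c *\<^sub>R y\<close> and the square of
  \<open>y \<bullet> u + c\<close>.\<close>

lemma second_order_points_subset_Omega:
  assumes "y \<in> second_order_points"
  shows "y \<in> Omega H Q b"
proof -
  have grad: "grad y = 0" and psd: "psd (hess y)"
    using assms by (auto simp: second_order_points_def)
  define z where "z = y \<bullet> (hess y *v y)"
  have trace: "(\<chi> i. trace (H i ** outer y)) = contract H y *v y"
    by (simp add: vec_eq_iff trace_mult_outer contract_nth)
  have "y \<bullet> grad y = 0" and grad_nth: "grad y $ i = 0" for i
    by (simp_all add: grad)
  then have "1/2 * trace (Q ** outer y) + b \<bullet> y + z / 2 = 0"
    by (simp add: z_def hess_mult_vec trace_mult_outer grad_def inner_add_right inner_commute field_simps)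
  moreover have "1/2 * trace (H i ** outer y) + axis i 1 \<bullet> (Q *v y) + b $ i = 0" for i
    using grad_nth[of i] by (simp add: grad_def trace_mult_outer contract_nth inner_axis')
  moreover have "psd (bordered (hess y) (hess y *v y) z)"
  proof -
    have "u \<bullet> (hess y *v u) + 2 * c * ((hess y *v y) \<bullet> u) + c\<^sup>2 * z =
        (u + c *\<^sub>R y) \<bullet> (hess y *v (u + c *\<^sub>R y))" for u c
      unfolding quadratic_form_add_scaleR[OF transpose_hess] z_def
      using inner_symmetric_matrix[OF transpose_hess, of y y u] by (simp add: inner_commute)
    then show ?thesis
      using psd unfolding psd_bordered_iff by (simp add: psd_def)
  qed
  moreover have "psd (bordered (outer y) y 1)"
  proof -
    have "u \<bullet> (outer y *v u) + 2 * c * (y \<bullet> u) + c\<^sup>2 * 1 = (y \<bullet> u + c)\<^sup>2" for u c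
      by (simp add: outer_mult_vec inner_commute power2_eq_square algebra_simps)
    then show ?thesis
      by (simp add: psd_bordered_iff)
  qed
  moreover have "(\<Sum>i\<in>UNIV. trace (H i ** outer y) *\<^sub>R axis i 1) = contract H y *v y"
    unfolding trace[symmetric] by (simp add: vec_eq_iff axis_def if_distrib cong: if_cong)
  ultimately show ?thesis
    unfolding Omega_def mem_Collect_eq
    by (intro exI[of _ "outer y"] exI[of _ z]) (simp add: hess_mult_vec flip: contract_def hess_def)
qed

text \<open>The two bordered matrices, with the sign of the border of the second one flipped, have
  trace product zero by the linear constraints, so they are complementary: the quadratic function
  of the first one vanishes at \<open>- y\<close> and is hence stationary there.\<close>

lemma Omega_subset_second_order_points:
  assumes "y \<in> Omega H Q b"
  shows "y \<in> second_order_points"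
proof -
  from assms obtain Y z where
    Y: "transpose Y = Y" and
    zero: "1/2 * trace (Q ** Y) + b \<bullet> y + z / 2 = 0" and
    stat: "\<And>i. 1/2 * trace (H i ** Y) + axis i 1 \<bullet> (Q *v y) + b $ i = 0" and
    psd1: "psd (bordered ((\<Sum>i\<in>UNIV. y $ i *\<^sub>R H i) + Q)
            ((\<Sum>i\<in>UNIV. trace (H i ** Y) *\<^sub>R axis i 1) + Q *v y) z)" and
    psd2: "psd (bordered Y y 1)"
    unfolding Omega_def by blast
  define \<tau> where "\<tau> = (\<chi> i. trace (H i ** Y))"
  define w where "w = \<tau> + Q *v y"
  have "(\<Sum>i\<in>UNIV. trace (H i ** Y) *\<^sub>R axis i 1) = \<tau>"
    by (simp add: \<tau>_def vec_eq_iff axis_def if_distrib cong: if_cong)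
  then have quad: "0 \<le> u \<bullet> (hess y *v u) + 2 * c * (w \<bullet> u) + c\<^sup>2 * z" for u c
    using psd1 unfolding psd_bordered_iff by (simp add: hess_def contract_def w_def)
  have psd: "psd (hess y)"
    using quad[of _ 0] by (simp add: psd_def transpose_hess)
  have g: "(1/2) *\<^sub>R \<tau> + Q *v y + b = 0"
    using stat by (simp add: vec_eq_iff \<tau>_def inner_axis')
  have "psd (Y - outer y)"
  proof -
    have "0 \<le> u \<bullet> ((Y - outer y) *v u)" for u
    proof -
      \<comment> \<open>The last entry \<open>- (y \<bullet> u)\<close> minimises the bordered form
        over \<open>c\<close>, which yields the Schur complement \<open>Y - outer y\<close>.\<close>
      have "0 \<le> u \<bullet> (Y *v u) + 2 * (- (y \<bullet> u)) * (y \<bullet> u) + (- (y \<bullet> u))\<^sup>2 * 1"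
        using psd2 unfolding psd_bordered_iff by blast
      also have "\<dots> = u \<bullet> ((Y - outer y) *v u)"
        by (simp add: matrix_vector_mult_diff_rdistrib outer_mult_vec inner_diff_right
            inner_commute power2_eq_square)
      finally show ?thesis .
    qed
    then show ?thesis
      using Y transpose_outer[of y] by (simp add: psd_def transpose_def vec_eq_iff)
  qed
  then have "0 \<le> trace (hess y ** (Y - outer y))"
    by (rule trace_mult_psd_nonneg[OF psd])
  moreover have "trace (hess y ** Y) = trace (hess y ** (Y - outer y)) + y \<bullet> (hess y *v y)"
    using matrix_add_ldistrib[of "hess y" "Y - outer y" "outer y"]
    by (simp add: trace_add trace_mult_outer)
  moreover have "trace (hess y ** Y) = y \<bullet> \<tau> + trace (Q ** Y)"
    by (simp add: hess_def trace_mult_add_left trace_contract \<tau>_def)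
  moreover have "1/2 * (y \<bullet> \<tau>) + y \<bullet> (Q *v y) + b \<bullet> y = 0"
    using arg_cong[OF g, of "inner y"] by (simp add: inner_add_right inner_commute)
  moreover have "0 \<le> (- y) \<bullet> (hess y *v (- y)) + 2 * (w \<bullet> (- y)) + z"
    using quad[of "- y" 1] by simp
  moreover have "(- y) \<bullet> (hess y *v (- y)) + 2 * (w \<bullet> (- y)) + z =
      y \<bullet> (hess y *v y) - 2 * (y \<bullet> \<tau>) - 2 * (y \<bullet> (Q *v y)) + z"
    using matrix_vector_mult_scaleR[of "hess y" "- 1" y]
    by (simp add: w_def inner_add_left inner_add_right inner_commute)
  \<comment> \<open>Nonnegativity is already known. For the upper bound, replace
    \<open>y \<bullet> (hess y *v y)\<close> by the larger trace with \<open>Y\<close> and eliminate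
    \<open>trace (Q ** Y) + z\<close> by \<open>zero\<close>; what remains is -2 times the inner
    product of \<open>y\<close> with \<open>g\<close>, which is 0.\<close>
  ultimately have "(- y) \<bullet> (hess y *v (- y)) + 2 * (w \<bullet> (- y)) + z = 0"
    using zero by linarith
  moreover have "0 \<le> u \<bullet> (hess y *v u) + 2 * (w \<bullet> u) + z" for u
    using quad[of u 1] by simp
  ultimately have "hess y *v (- y) + w = 0"
    using nonneg_quadratic_stationary[OF transpose_hess] by blast
  \<comment> \<open>The terms in \<open>Q\<close> cancel, and with this value of
    \<open>\<tau>\<close> the equation \<open>g\<close> says \<open>grad y = 0\<close>.\<close>
  then have "\<tau> = contract H y *v y"
    using matrix_vector_mult_scaleR[of "hess y" "- 1" y] by (simp add: w_def hess_mult_vec)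
  then show ?thesis
    using g psd by (simp add: second_order_points_def grad_def)
qed

lemma Omega_eq_second_order_points: "Omega H Q b = second_order_points"
  by (rule set_eqI) (rule iffI[OF Omega_subset_second_order_points second_order_points_subset_Omega])

text \<open>A point of the relative interior lies strictly between any local minimum and another point
  of \<open>\<Omega>\<close>; since the Hessian is affine, its kernel there is contained in the kernel of the Hessian
  at the local minimum.\<close>

lemma rel_interior_Omega_local_minimum:
  assumes "convex (Omega H Q b)" and "local_minimum (cubic H Q b) x0" and "x \<in> rel_interior (Omega H Q b)"
  shows "local_minimum (cubic H Q b) x"
proof -
  have x0: "x0 \<in> Omega H Q b" "third_order_condition x0"
    using assms(2) by (simp_all add: local_minimum_iff Omega_eq_second_order_points)
  then have "Omega H Q b \<noteq> {}"
    by blast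
  from assms(3) x0(1) obtain l where l: "1 < l" "l *\<^sub>R x + (1 - l) *\<^sub>R x0 \<in> Omega H Q b"
    and x: "x \<in> Omega H Q b"
    unfolding rel_interior_prolongation[OF assms(1) \<open>Omega H Q b \<noteq> {}\<close>] by blast
  define y where "y = l *\<^sub>R x + (1 - l) *\<^sub>R x0"
  \<comment> \<open>The weights \<open>l - 1\<close> and \<open>1\<close> add up to
    \<open>l\<close>, so the constant part \<open>Q\<close> of the affine Hessian matches
    too.\<close>
  have hess: "(l - 1) *\<^sub>R hess x0 + 1 *\<^sub>R hess y = l *\<^sub>R hess x"
    unfolding hess_def y_def contract_add contract_scaleR by (simp add: algebra_simps)
  have psd: "psd (hess x0)" "psd (hess y)"
    using x0(1) l(2) by (simp_all add: Omega_eq_second_order_points second_order_points_def y_def)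
  have "hess x0 *v d = 0" if "hess x *v d = 0" for d
    using psd_combination_kernel[OF psd, of "l - 1" 1 d] l(1) that unfolding hess
    by (simp add: scaleR_matrix_vector_assoc[symmetric])
  then show ?thesis
    using x0(2) x by (auto simp: local_minimum_iff Omega_eq_second_order_points third_order_condition_def)
qed

end

section \<open>Finding a point in the relative interior\<close>

lemma convex_sdp_feasible:
  assumes "is_sdp P"
  shows "convex (sdp_feasible P)"
proof (rule convexI)
  fix u v and s t :: real
  assume u: "u \<in> sdp_feasible P" and v: "v \<in> sdp_feasible P" and st: "0 \<le> s" "0 \<le> t" "s + t = 1"
  have "a (s *\<^sub>R u + t *\<^sub>R v) = \<beta>" if a: "(a, \<beta>) \<in> equalities P" for a \<beta>
  proof -
    have "linear a" "a u = \<beta>" "a v = \<beta>"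
      using assms a u v by (auto simp: is_sdp_def sdp_feasible_def)
    then have "a (s *\<^sub>R u + t *\<^sub>R v) = (s + t) * \<beta>"
      by (simp add: linear_add linear_scale algebra_simps)
    then show ?thesis
      using st by simp
  qed
  moreover have "psd (A (s *\<^sub>R u + t *\<^sub>R v) + A0)" if A: "(A, A0) \<in> lmis P" for A A0
  proof -
    have "linear A" "psd (A u + A0)" "psd (A v + A0)"
      using assms A u v by (auto simp: is_sdp_def sdp_feasible_def)
    moreover have "A (s *\<^sub>R u + t *\<^sub>R v) + (s + t) *\<^sub>R A0 = s *\<^sub>R (A u + A0) + t *\<^sub>R (A v + A0)"
      using \<open>linear A\<close> by (simp add: linear_add linear_scale scaleR_add_left scaleR_add_right)
    ultimately show ?thesis
      using psd_convex_combination st by (metis scaleR_one)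
  qed
  ultimately show "s *\<^sub>R u + t *\<^sub>R v \<in> sdp_feasible P"
    by (auto simp: sdp_feasible_def)
qed

section \<open>Coordinate programs and their optimal values\<close>

lemma linear_decision_coord: "linear (\<lambda>(y, Y, z). y $ i :: real)"
  by (auto intro!: linearI)

lemma is_sdp_optimize_coord: "is_sdp P \<Longrightarrow> is_sdp (optimize_coord s i P)"
  by (simp add: is_sdp_def optimize_coord_def linear_decision_coord)

lemma is_sdp_fix_coord: "is_sdp P \<Longrightarrow> is_sdp (fix_coord i t P)"
  by (simp add: is_sdp_def fix_coord_def linear_decision_coord)

lemma sdp_feasible_optimize_coord: "sdp_feasible (optimize_coord s i P) = sdp_feasible P"
  by (simp add: sdp_feasible_def optimize_coord_def)

text \<open>The new equality involves only the \<open>y\<close> component, so slicing commutes with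
  projecting; thus the programs represent the sets \<open>S_i\<close>.\<close>

lemma projection_fix_coord:
  "fst ` sdp_feasible (fix_coord i t P) = fst ` sdp_feasible P \<inter> {y. y $ i = t}"
proof -
  have "sdp_feasible (fix_coord i t P) = sdp_feasible P \<inter> {v. fst v $ i = t}"
    by (simp add: sdp_feasible_def fix_coord_def case_prod_unfold) blast
  then show ?thesis
    by auto
qed

lemma supremum_of_sdp_answer:
  fixes P :: "'n::finite program" and i :: 'n
  defines "J \<equiv> (\<lambda>y. y $ i) ` fst ` sdp_feasible P"
  assumes "sdp_feasible P \<noteq> {}"
  shows "supremum_of (sdp_answer (optimize_coord Maximize i P)) =
    (if bdd_above J then ereal (Sup J) else \<infinity>)"
proof -
  have "(\<lambda>(y, Y, z). y $ i) ` sdp_feasible P = J"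
    by (simp add: J_def image_image case_prod_unfold)
  then show ?thesis
    using assms(2) by (simp add: sdp_answer_def sdp_feasible_optimize_coord)
      (simp add: optimize_coord_def)
qed

lemma infimum_of_sdp_answer:
  fixes P :: "'n::finite program" and i :: 'n
  defines "J \<equiv> (\<lambda>y. y $ i) ` fst ` sdp_feasible P"
  assumes "sdp_feasible P \<noteq> {}"
  shows "infimum_of (sdp_answer (optimize_coord Minimize i P)) =
    (if bdd_below J then ereal (Inf J) else - \<infinity>)"
proof -
  have "(\<lambda>(y, Y, z). y $ i) ` sdp_feasible P = J"
    by (simp add: J_def image_image case_prod_unfold)
  then show ?thesis
    using assms(2) by (simp add: sdp_answer_def sdp_feasible_optimize_coord)
      (simp add: optimize_coord_def)
qed

lemma candidates_nonempty:
  fixes J :: "real set"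
  assumes "J \<noteq> {}"
  shows "candidates (if bdd_below J then ereal (Inf J) else - \<infinity>)
    (if bdd_above J then ereal (Sup J) else \<infinity>) \<noteq> {}" (is "candidates ?l ?u \<noteq> {}")
proof (cases "?l = ?u")
  case True
  \<comment> \<open>Equal bounds must both be finite, since the infinite default values
    differ.\<close>
  then have "ereal (Inf J) = ?l"
    by (auto split: if_splits)
  then have "Inf J \<in> candidates ?l ?u"
    unfolding candidates_def mem_Collect_eq if_P[OF True] .
  then show ?thesis
    by blast
next
  case False
  obtain a where "a \<in> J"
    using assms by blast
  have "?l \<le> ereal a"
    using \<open>a \<in> J\<close> by (simp add: cInf_lower)
  moreover have "ereal a \<le> ?u"
    using \<open>a \<in> J\<close> by (simp add: cSup_upper)
  ultimately have "?l \<le> ?u"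
    by (rule order_trans)
  then have "?l < ?u"
    using False by (rule le_neq_trans)
  then obtain t where "?l < ereal t" "ereal t < ?u"
    using ereal_dense2 by blast
  then show ?thesis
    using False unfolding candidates_def by auto
qed

text \<open>If the bounds coincide, \<open>J\<close> is a singleton and its own relative interior.
  Otherwise \<open>J\<close> has points on both sides of \<open>t\<close>, so by convexity it
  contains an open interval around \<open>t\<close>.\<close>

lemma candidates_subset_rel_interior:
  fixes J :: "real set"
  assumes "convex J" and "J \<noteq> {}"
    and t: "t \<in> candidates (if bdd_below J then ereal (Inf J) else - \<infinity>)
      (if bdd_above J then ereal (Sup J) else \<infinity>)" (is "t \<in> candidates ?l ?u")
  shows "t \<in> rel_interior J"
proof (cases "?l = ?u")
  case True
  then have "bdd_below J" "bdd_above J" "Inf J = Sup J"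
    by (auto split: if_splits)
  then have "t = Inf J"
    using t True by (simp add: candidates_def)
  have "a = t" if "a \<in> J" for a
    using cInf_lower[OF that \<open>bdd_below J\<close>] cSup_upper[OF that \<open>bdd_above J\<close>]
      \<open>Inf J = Sup J\<close> \<open>t = Inf J\<close> by linarith
  then have "J = {t}"
    using assms(2) by blast
  then show ?thesis
    by simp
next
  case False
  then have lt: "?l < ereal t" "ereal t < ?u"
    using t by (simp_all add: candidates_def)
  have "\<exists>a\<in>J. a < t"
  proof (cases "bdd_below J")
    case True
    then show ?thesis
      using lt(1) cInf_less_iff[OF assms(2)] by simp
  qed (meson bdd_belowI not_le)
  moreover have "\<exists>c\<in>J. t < c"
  proof (cases "bdd_above J")
    case True
    then show ?thesis
      using lt(2) less_cSup_iff[OF assms(2)] by simp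
  qed (meson bdd_aboveI not_le)
  ultimately obtain a c where ac: "a \<in> J" "a < t" "c \<in> J" "t < c"
    by blast
  have "{a..c} \<subseteq> J"
    using closed_segment_subset[OF ac(1,3) assms(1)] ac(2,4) by (simp add: closed_segment_eq_real_ivl)
  then have "{a<..<c} \<subseteq> J"
    by auto
  then have "t \<in> interior J"
    using ac by (intro interiorI[of "{a<..<c}"]) auto
  then show ?thesis
    using interior_subset_rel_interior by blast
qed

text \<open>Relative interiors commute with linear images, so the hyperplane at a relative interior
  value meets \<open>rel_interior S\<close>; for an affine set meeting it, they also commute with
  intersection.\<close>

lemma rel_interior_coord_slice:
  fixes S :: "(real^'n) set"
  assumes "convex S" and "t \<in> rel_interior ((\<lambda>y. y $ i) ` S)"
  shows "rel_interior (S \<inter> {y. y $ i = t}) = rel_interior S \<inter> {y. y $ i = t}"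
    and "S \<inter> {y. y $ i = t} \<noteq> {}"
proof -
  have "linear (\<lambda>y::real^'n. y $ i)"
    by (auto intro!: linearI)
  then have "t \<in> (\<lambda>y. y $ i) ` rel_interior S"
    using assms rel_interior_convex_linear_image by blast
  then have ne: "rel_interior S \<inter> {y. y $ i = t} \<noteq> {}"
    by blast
  then show "S \<inter> {y. y $ i = t} \<noteq> {}"
    using rel_interior_subset by blast
  have "affine {y::real^'n. y $ i = t}"
    by (simp add: affine_def flip: distrib_right)
  then show "rel_interior (S \<inter> {y. y $ i = t}) = rel_interior S \<inter> {y. y $ i = t}"
    using convex_affine_rel_interior_Int[OF assms(1) _ ne] by blast
qed

text \<open>Induction over the coordinates still to be fixed. The last hypothesis is the invariant
  that all other coordinates are constant on the current set, with values recorded in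
  \<open>x\<close>.\<close>

lemma choose_coords_correct:
  fixes P :: "'n::finite program" and i :: 'n
  assumes E: "E_SDP_oracle E"
    and "is_sdp P" and "sdp_feasible P \<noteq> {}" and "distinct is"
    and "\<And>y j. y \<in> fst ` sdp_feasible P \<Longrightarrow> j \<notin> set is \<Longrightarrow> y $ j = x $ j"
  shows "never_stuck E (choose_coords is P x) \<and>
    (\<forall>(calls, x')\<in>outcomes E (choose_coords is P x).
      calls = 2 * length is \<and> x' \<in> rel_interior (fst ` sdp_feasible P))"
  using assms(2-)
proof (induction "is" arbitrary: P x)
  case Nil
  \<comment> \<open>With no coordinate left the current set is \<open>{x}\<close>, which is its own
    relative interior.\<close>
  have "y = x" if "y \<in> fst ` sdp_feasible P" for y
    using Nil.prems(4)[OF that] by (simp add: vec_eq_iff)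
  then have "fst ` sdp_feasible P = {x}"
    using Nil.prems(2) subset_singletonD[of "fst ` sdp_feasible P" x] by (metis image_is_empty singletonI subsetI)
  then show ?case
    by simp
next
  case (Cons i "is")
  define S where "S = fst ` sdp_feasible P"
  define J where "J = (\<lambda>y. y $ i) ` S"
  have "convex S"
    unfolding S_def using convex_sdp_feasible[OF Cons.prems(1)]
    by (rule convex_linear_image[OF linear_fst])
  have lin: "linear (\<lambda>y::real^'n. y $ i)"
    by (auto intro!: linearI)
  have J: "convex J" "J \<noteq> {}"
    using Cons.prems(2) convex_linear_image[OF lin \<open>convex S\<close>] by (auto simp: J_def S_def)
  define C where "C = candidates (infimum_of (E (optimize_coord Minimize i P)))
    (supremum_of (E (optimize_coord Maximize i P)))"
  have C: "C = candidates (if bdd_below J then ereal (Inf J) else - \<infinity>)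
      (if bdd_above J then ereal (Sup J) else \<infinity>)"
  proof -
    have "E (optimize_coord s i P) = sdp_answer (optimize_coord s i P)" for s
      using E is_sdp_optimize_coord[OF Cons.prems(1)] by (simp add: E_SDP_oracle_def)
    then show ?thesis
      unfolding C_def J_def S_def
      by (simp add: supremum_of_sdp_answer infimum_of_sdp_answer Cons.prems(2))
  qed
  define x' where "x' t = (\<chi> j. if j = i then t else x $ j)" for t
  have step: "never_stuck E (choose_coords is (fix_coord i t P) (x' t)) \<and>
      (\<forall>(calls, y)\<in>outcomes E (choose_coords is (fix_coord i t P) (x' t)).
        calls = 2 * length is \<and> y \<in> rel_interior S)" if "t \<in> C" for t
  proof -
    have "t \<in> rel_interior ((\<lambda>y. y $ i) ` S)"
      using candidates_subset_rel_interior[OF J] that by (simp add: C J_def)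
    note slice = rel_interior_coord_slice[OF \<open>convex S\<close> this]
    have proj: "fst ` sdp_feasible (fix_coord i t P) = S \<inter> {y. y $ i = t}"
      by (simp add: projection_fix_coord S_def)
    have "y $ j = x' t $ j" if "y \<in> fst ` sdp_feasible (fix_coord i t P)" "j \<notin> set is" for y j
      using that Cons.prems(4)[of y j] unfolding proj by (auto simp: x'_def S_def)
    moreover have "sdp_feasible (fix_coord i t P) \<noteq> {}"
      using slice(2) proj by auto
    \<comment> \<open>The induction hypothesis reaches the relative interior of the slice, which
      \<open>slice(1)\<close> places inside that of \<open>S\<close>.\<close>
    ultimately show ?thesis
      using Cons.IH[OF is_sdp_fix_coord[OF Cons.prems(1)], of i t "x' t"] Cons.prems(3) slice(1)
      unfolding proj by auto
  qed
  have "C \<noteq> {}"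
    unfolding C by (rule candidates_nonempty[OF J(2)])
  moreover have "choose_coords (i # is) P x =
    Call (optimize_coord Maximize i P) (\<lambda>sup_ans.
    Call (optimize_coord Minimize i P) (\<lambda>inf_ans.
    Choose (candidates (infimum_of inf_ans) (supremum_of sup_ans)) (\<lambda>t.
    choose_coords is (fix_coord i t P) (x' t))))"
    by (simp add: x'_def)
  ultimately show ?case
    using step by (fastforce simp: C_def[symmetric] S_def[symmetric])
qed

section \<open>Correctness of the whole algorithm\<close>

lemma outcomes_bind_Return:
  "outcomes E (bind c (\<lambda>x. Return (f x))) = (\<lambda>(m, x). (m, f x)) ` outcomes E c"
  by (induction c) (auto simp: image_image image_UN case_prod_unfold)

lemma never_stuck_bind_Return:
  "never_stuck E (bind c (\<lambda>x. Return (f x))) = never_stuck E c"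
  by (induction c) auto

theorem mainTheorem16:
  fixes H :: "'n::{finite,linorder} \<Rightarrow> 'n sqmat" and Q :: "'n sqmat" and b :: "(real, 'n) vec"
    and p :: "(real, 'n) vec \<Rightarrow> real" and E :: "'n program \<Rightarrow> answer"
  assumes "\<And>x. p x = 1/6 * (\<Sum>i\<in>UNIV. x \<bullet> ((x $ i *\<^sub>R H i) *v x)) + 1/2 * (x \<bullet> (Q *v x)) + b \<bullet> x"
    and "\<And>i. transpose (H i) = H i"
    and "transpose Q = Q"
    and "\<And>i j k. H i $ j $ k = H j $ i $ k \<and> H j $ i $ k = H k $ i $ j"
    and "E_SDP_oracle E"
  shows
    "(Omega H Q b \<noteq> {} \<longrightarrow>
        never_stuck E (find_relint_point H Q b) \<and>
        (\<forall>(calls, x)\<in>outcomes E (find_relint_point H Q b).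
           calls = 2 * CARD('n) \<and> x \<in> rel_interior (Omega H Q b))) \<and>
     never_stuck E (algorithm H Q b) \<and>
     (\<forall>(calls, r)\<in>outcomes E (algorithm H Q b).
        calls \<le> 2 * CARD('n) + 1 \<and>
        ((\<exists>x. local_minimum p x) \<longrightarrow> (\<exists>x. r = LocalMinimum x \<and> local_minimum p x)) \<and>
        ((\<nexists>x. local_minimum p x) \<longrightarrow> r = NoLocalMinimum))"
proof -
  interpret symmetric_cubic H Q b
    by unfold_locales (rule assms(2), rule assms(3), rule conjunct1[OF assms(4)])
  have p: "p = cubic H Q b"
    by (simp add: fun_eq_iff assms(1) cubic_def cubic_part_def)
  have sdp: "is_sdp (Omega_sdp H Q b)"
    by (rule is_sdp_Omega_sdp[OF assms(2,3)])
  have convex: "convex (Omega H Q b)"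
    unfolding Omega_eq_projection using convex_sdp_feasible[OF sdp]
    by (rule convex_linear_image[OF linear_fst])
  have find: "never_stuck E (find_relint_point H Q b) \<and>
      (\<forall>(calls, x)\<in>outcomes E (find_relint_point H Q b).
         calls = 2 * CARD('n) \<and> x \<in> rel_interior (Omega H Q b))" if "Omega H Q b \<noteq> {}"
    using choose_coords_correct[OF assms(5) sdp, of "sorted_list_of_set UNIV" 0] that
    by (simp add: find_relint_point_def Omega_eq_projection)
  \<comment> \<open>The test is exact, so no wrong point is ever returned; it remains to exclude a
    rejected candidate when a local minimum exists.\<close>
  have test: "passes_test H Q b x \<longleftrightarrow> local_minimum p x" for x
    by (simp add: p passes_test_iff local_minimum_iff)
  have infeasible: "E (Omega_sdp H Q b) = Infeasible \<longleftrightarrow> Omega H Q b = {}"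
    using assms(5) sdp
    by (simp add: E_SDP_oracle_def sdp_answer_def Omega_eq_projection Let_def split: sense.splits)
  have "never_stuck E (algorithm H Q b) \<and>
     (\<forall>(calls, r)\<in>outcomes E (algorithm H Q b).
        calls \<le> 2 * CARD('n) + 1 \<and>
        ((\<exists>x. local_minimum p x) \<longrightarrow> (\<exists>x. r = LocalMinimum x \<and> local_minimum p x)) \<and>
        ((\<nexists>x. local_minimum p x) \<longrightarrow> r = NoLocalMinimum))"
  proof (cases "Omega H Q b = {}")
    case True
    then have "\<nexists>x. local_minimum p x"
      by (simp add: p local_minimum_iff Omega_eq_second_order_points[symmetric])
    then show ?thesis
      using True infeasible by (simp add: algorithm_def)
  next
    case False
    \<comment> \<open>One local minimum \<open>x0\<close> makes every point that the search can
      produce a local minimum, so the test then accepts in every run.\<close>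
    have "local_minimum p x" if "local_minimum p x0" "x \<in> rel_interior (Omega H Q b)" for x x0
      using rel_interior_Omega_local_minimum[OF convex] that unfolding p by blast
    then show ?thesis
      using False infeasible find[OF False]
      by (fastforce simp: algorithm_def outcomes_bind_Return never_stuck_bind_Return test)
  qed
  with find show ?thesis
    by blast
qed

end
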